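(* For any integers $k\ge1$ and $n>k$, the best-possible guarantee for oblivious static threshold algorithms relative to the prophet, $\alpha^{\mathsf{OST}/\mathsf{Proph}}_{k,n}$, and the best-possible guarantee relative to the ex-ante relaxation, $\alpha^{\mathsf{OST}/\mathsf{ExAnte}}_{k,n}$, are both equal to the optimal value of the problem $$\min\ \alpha\quad\text{s.t.}\quad \alpha=\Pr\Big[\sum_{i=1}^{n-1}\mathrm{Ber}(q_i)<k\Big]=\frac{\mathbb E[\min\{\sum_{i=1}^{n-1}\mathrm{Ber}(q_i),k\}]}{k},\qquad q_i\in[0,1]\ \ \forall i\in\{1,\dots,n-1\}.$$
   Context: $[n]=\{1,\dots,n\}$. $\mathrm{Ber}(p)$ denotes a Bernoulli random variable with mean $p$; all Bernoulli variables in a sum are independent. An instance consists of $k$ slots, $n$ agents, type distributions $\mathbf G$ and valuations. Type distributions $\mathbf G$: a positive integer $m$ (number of types) and numbers $G_{ij}$ with $0=G_{i0}\le G_{i1}\le\cdots\le G_{im}=1$ for every $i\in[n]$; put $p_{ij}=G_{ij}-G_{i,j-1}$. Valuations: $r_1\ge\cdots\ge r_m\ge0$, not all zero. Agents $i=1,\dots,n$ arrive in this order; agent $i$ independently has type $j$ with probability $p_{ij}$, in which case its valuation is $R_i=r_j$. Static threshold policy $(J,\rho)$, $J\in[m]$, $\rho\in(0,1]$: while slots remain (there are $k$ in total), it accepts each arriving agent of type $j<J$, accepts each arriving agent of type exactly $J$ according to an independent coin flip of probability $\rho$, and rejects all others. $\mathsf{ALG}_{J,\rho}(\mathbf G,r)$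 denotes the expected total valuation of the agents it accepts. Benchmarks: $\mathsf{Proph}(\mathbf G,r)=\mathbb E[\max_{S\subseteq[n],|S|\le k}\sum_{i\in S}R_i]$, and $\mathsf{ExAnte}(\mathbf G,r)=\max\{\sum_{j=1}^m r_ja_j:\ \sum_{j=1}^m a_j\le k,\ 0\le a_j\le\sum_{i=1}^np_{ij}\ \forall j\in[m]\}$. An oblivious static threshold algorithm chooses $(J,\rho)$ knowing $\mathbf G$ but not the valuations. Its best-possible (tight) guarantees are $$\alpha^{\mathsf{OST}/\mathsf{Proph}}_{k,n}=\inf_{\mathbf G}\ \sup_{J\in[m],\rho\in(0,1]}\ \inf_{r}\ \frac{\mathsf{ALG}_{J,\rho}(\mathbf G,r)}{\mathsf{Proph}(\mathbf G,r)},\qquad \alpha^{\mathsf{OST}/\mathsf{ExAnte}}_{k,n}=\inf_{\mathbf G}\ \sup_{J\in[m],\rho\in(0,1]}\ \inf_{r}\ \frac{\mathsf{ALG}_{J,\rho}(\mathbf G,r)}{\mathsf{ExAnte}(\mathbf G,r)},$$ where $\inf_r$ ranges over valuations for which the denominator is positive. *)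

theory Defs
  imports "HOL-Probability.Probability"
begin

text \<open>
  Agents are \<open>1, \<dots>, n\<close> and types are \<open>1, \<dots>, m\<close>.  Type distributions \<open>G i j\<close> matter only for
  \<open>1 \<le> i \<le> n\<close> and \<open>0 \<le> j \<le> m\<close>, valuations \<open>r j\<close> only for \<open>1 \<le> j \<le> m\<close>.
\<close>

definition type_dists :: "nat \<Rightarrow> nat \<Rightarrow> (nat \<Rightarrow> nat \<Rightarrow> real) \<Rightarrow> bool" where
  "type_dists n m G \<longleftrightarrow> 1 \<le> m \<and>
     (\<forall>i\<in>{1..n}. G i 0 = 0 \<and> (\<forall>j\<in>{1..m}. G i (j - 1) \<le> G i j) \<and> G i m = 1)"

definition valuations :: "nat \<Rightarrow> (nat \<Rightarrow> real) \<Rightarrow> bool" where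
  "valuations m r \<longleftrightarrow>
     (\<forall>j\<in>{1..m}. 0 \<le> r j) \<and> (\<forall>j\<in>{1..<m}. r (j + 1) \<le> r j) \<and> (\<exists>j\<in>{1..m}. r j \<noteq> 0)"

definition type_prob :: "(nat \<Rightarrow> nat \<Rightarrow> real) \<Rightarrow> nat \<Rightarrow> nat \<Rightarrow> real" where
  "type_prob G i j = G i j - G i (j - 1)"

definition type_pmf :: "nat \<Rightarrow> (nat \<Rightarrow> nat \<Rightarrow> real) \<Rightarrow> nat \<Rightarrow> nat pmf" where
  "type_pmf m G i = embed_pmf (\<lambda>j. if j \<in> {1..m} then type_prob G i j else 0)"

text \<open>\<open>embed_pmf\<close> is only meaningful on probability vectors; this is where admissibility is used.\<close>

lemma pmf_type_pmf:
  assumes "type_dists n m G" and "i \<in> {1..n}"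
  shows "pmf (type_pmf m G i) j = (if j \<in> {1..m} then type_prob G i j else 0)"
proof -
  let ?f = "\<lambda>j. if j \<in> {1..m} then type_prob G i j else 0"
  have G: "G i 0 = 0" "G i m = 1" "\<And>j. j \<in> {1..m} \<Longrightarrow> G i (j - 1) \<le> G i j"
    using assms by (auto simp: type_dists_def)
  have nonneg: "0 \<le> ?f j" for j
    using G(3) by (auto simp: type_prob_def)
  have "(\<Sum>j\<in>{1..m}. type_prob G i j) = G i m - G i 0"
    using sum_telescope''[of 0 m "G i"]
    by (simp add: type_prob_def atLeastSucAtMost_greaterThanAtMost)
  then have "(\<Sum>j\<in>{1..m}. ?f j) = 1"
    using G by simp
  moreover have "(\<integral>\<^sup>+ j. ennreal (?f j) \<partial>count_space UNIV) = (\<Sum>j\<in>{1..m}. ennreal (?f j))"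
    by (rule nn_integral_count_space') auto
  moreover have "(\<Sum>j\<in>{1..m}. ennreal (?f j)) = ennreal (\<Sum>j\<in>{1..m}. ?f j)"
    by (rule sum_ennreal) (rule nonneg)
  ultimately have "(\<integral>\<^sup>+ j. ennreal (?f j) \<partial>count_space UNIV) = 1"
    by simp
  then show ?thesis
    unfolding type_pmf_def by (intro pmf_embed_pmf nonneg)
qed

definition types_pmf :: "nat \<Rightarrow> nat \<Rightarrow> (nat \<Rightarrow> nat \<Rightarrow> real) \<Rightarrow> (nat \<Rightarrow> nat) pmf" where
  "types_pmf n m G = Pi_pmf {1..n} 0 (type_pmf m G)"

text \<open>
  \<open>accepted k J t c i\<close> is the set of agents among \<open>1, \<dots>, i\<close> accepted by the static threshold
  policy with \<open>k\<close> slots and threshold type \<open>J\<close>, when agent \<open>i\<close> has type \<open>t i\<close> and its coin shows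
  \<open>c i\<close>.  Every agent gets a coin, but only the coins of agents of type \<open>J\<close> are looked at.
\<close>

fun accepted :: "nat \<Rightarrow> nat \<Rightarrow> (nat \<Rightarrow> nat) \<Rightarrow> (nat \<Rightarrow> bool) \<Rightarrow> nat \<Rightarrow> nat set" where
  "accepted k J t c 0 = {}"
| "accepted k J t c (Suc i) =
     (let A = accepted k J t c i in
      if card A < k \<and> (t (Suc i) < J \<or> (t (Suc i) = J \<and> c (Suc i)))
      then insert (Suc i) A else A)"

definition ALG ::
  "nat \<Rightarrow> nat \<Rightarrow> nat \<Rightarrow> (nat \<Rightarrow> nat \<Rightarrow> real) \<Rightarrow> nat \<Rightarrow> real \<Rightarrow> (nat \<Rightarrow> real) \<Rightarrow> real" where
  "ALG k n m G J \<rho> r = measure_pmf.expectation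
     (pair_pmf (types_pmf n m G) (Pi_pmf {1..n} False (\<lambda>_. bernoulli_pmf \<rho>)))
     (\<lambda>(t, c). \<Sum>i\<in>accepted k J t c n. r (t i))"

definition Proph ::
  "nat \<Rightarrow> nat \<Rightarrow> nat \<Rightarrow> (nat \<Rightarrow> nat \<Rightarrow> real) \<Rightarrow> (nat \<Rightarrow> real) \<Rightarrow> real" where
  "Proph k n m G r = measure_pmf.expectation (types_pmf n m G)
     (\<lambda>t. Max ((\<lambda>S. \<Sum>i\<in>S. r (t i)) ` {S. S \<subseteq> {1..n} \<and> card S \<le> k}))"

text \<open>
  The supremum is a maximum: the objective is linear and the feasible region is a nonempty
  compact polytope in the coordinates \<open>a 1, \<dots>, a m\<close>.
\<close>

definition ExAnte ::
  "nat \<Rightarrow> nat \<Rightarrow> nat \<Rightarrow> (nat \<Rightarrow> nat \<Rightarrow> real) \<Rightarrow> (nat \<Rightarrow> real) \<Rightarrow> real" where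
  "ExAnte k n m G r = Sup {(\<Sum>j\<in>{1..m}. r j * a j) | a.
     (\<Sum>j\<in>{1..m}. a j) \<le> real k \<and>
     (\<forall>j\<in>{1..m}. 0 \<le> a j \<and> a j \<le> (\<Sum>i\<in>{1..n}. type_prob G i j))}"

text \<open>
  Tight guarantee of oblivious static threshold algorithms relative to a benchmark \<open>B\<close>.
  The infima and suprema are over nonempty sets of reals in \<open>[0, 1]\<close> whenever \<open>1 \<le> k\<close>, \<open>1 \<le> n\<close> and
  \<open>B\<close> is \<open>Proph\<close> or \<open>ExAnte\<close>: the ratios lie in \<open>[0, 1]\<close>, and constant positive valuations always
  have a positive benchmark.
\<close>

definition OST_guarantee ::
  "(nat \<Rightarrow> nat \<Rightarrow> nat \<Rightarrow> (nat \<Rightarrow> nat \<Rightarrow> real) \<Rightarrow> (nat \<Rightarrow> real) \<Rightarrow> real) \<Rightarrow> nat \<Rightarrow> nat \<Rightarrow> real" where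
  "OST_guarantee B k n =
     (INF (m, G)\<in>{(m, G). type_dists n m G}.
        SUP (J, \<rho>)\<in>{1..m} \<times> {0<..1}.
          INF r\<in>{r. valuations m r \<and> 0 < B k n m G r}. ALG k n m G J \<rho> r / B k n m G r)"

text \<open>The distribution of a sum of independent Bernoulli variables with means \<open>q i\<close>, \<open>i \<in> I\<close>.\<close>

definition bernoulli_sum_pmf :: "nat set \<Rightarrow> (nat \<Rightarrow> real) \<Rightarrow> nat pmf" where
  "bernoulli_sum_pmf I q =
     map_pmf (\<lambda>x. \<Sum>i\<in>I. of_bool (x i)) (Pi_pmf I False (\<lambda>i. bernoulli_pmf (q i)))"

definition feasible_values :: "nat \<Rightarrow> nat \<Rightarrow> real set" where
  "feasible_values k n = {\<alpha>. \<exists>q. (\<forall>i\<in>{1..n - 1}. q i \<in> {0..1}) \<and>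
     \<alpha> = measure_pmf.prob (bernoulli_sum_pmf {1..n - 1} q) {s. s < k} \<and>
     \<alpha> = measure_pmf.expectation (bernoulli_sum_pmf {1..n - 1} q) (\<lambda>s. real (min s k)) / real k}"

definition is_optimal_value :: "nat \<Rightarrow> nat \<Rightarrow> real \<Rightarrow> bool" where
  "is_optimal_value k n v \<longleftrightarrow>
     v \<in> feasible_values k n \<and> (\<forall>\<alpha>\<in>feasible_values k n. v \<le> \<alpha>)"

end

theory Submission
  imports Defs
begin

text \<open>
  Let \<open>q i\<close> be the probability that a policy wants agent \<open>i\<close>, and \<open>S\<^sub>j\<close> the sum of
  independent \<open>Ber(q i)\<close>, \<open>i \<le> j\<close>.

  Lower bound: pricing a slot at \<open>r J\<close> bounds either benchmark by \<open>k r\<^sub>J + \<Sum>\<^sub>i E[(R\<^sub>i - r\<^sub>J)\<^sup>+]\<close>.  The policy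
  collects \<open>r\<^sub>J\<close> for each slot it fills, plus \<open>(R\<^sub>i - r\<^sub>J)\<^sup>+\<close> whenever a slot is free for agent \<open>i\<close>, which
  happens, independently of \<open>R\<^sub>i\<close>, with probability at least \<open>P[S\<^sub>n\<^sub>-\<^sub>1 < k]\<close>.  Moving \<open>(J, \<rho>)\<close> continuously
  from accepting nobody to accepting everybody, the intermediate value theorem yields a policy with
  \<open>P[S\<^sub>n\<^sub>-\<^sub>1 < k] = E[min(S\<^sub>n\<^sub>-\<^sub>1, k)] / k\<close>; this common value is feasible, and the guarantee is at least it.

  Upper bound: given a feasible \<open>q\<close>, append a last agent that has the top type with small probability \<open>\<epsilon>\<close>.
  Less selective policies than \<open>q\<close> block this agent too often, more selective ones fill too few slots.
\<close>

section \<open>Sums of independent Bernoulli variables\<close>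

lemma expectation_pair_pmf_finite:
  fixes f :: "'a \<times> 'b \<Rightarrow> real"
  assumes "finite (set_pmf p)" "finite (set_pmf q)"
  shows "measure_pmf.expectation (pair_pmf p q) f =
    measure_pmf.expectation p (\<lambda>x. measure_pmf.expectation q (\<lambda>y. f (x, y)))"
proof -
  have "measure_pmf.expectation (pair_pmf p q) f =
      (\<Sum>x\<in>set_pmf p. pmf p x * measure_pmf.expectation (map_pmf (Pair x) q) f)"
    unfolding pair_pmf_def map_pmf_def[symmetric]
    using assms by (subst pmf_expectation_bind[of "set_pmf p"]) (auto simp: map_pmf_def)
  also have "\<dots> = measure_pmf.expectation p (\<lambda>x. measure_pmf.expectation q (\<lambda>y. f (x, y)))"
    using assms by (subst integral_measure_pmf_real[of "set_pmf p"]) (auto simp: mult.commute)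
  finally show ?thesis .
qed

lemma finite_set_Pi_pmf:
  assumes "finite A" "\<And>x. x \<in> A \<Longrightarrow> finite (set_pmf (p x))"
  shows "finite (set_pmf (Pi_pmf A d p))"
  unfolding set_Pi_pmf[OF assms(1)] using assms by (intro finite_PiE_dflt) auto

lemma expectation_Pi_pmf_insert:
  fixes f :: "('a \<Rightarrow> 'b) \<Rightarrow> real"
  assumes "finite A" "x \<notin> A" "\<And>y. y \<in> insert x A \<Longrightarrow> finite (set_pmf (p y))"
  shows "measure_pmf.expectation (Pi_pmf (insert x A) d p) f =
    measure_pmf.expectation (p x)
      (\<lambda>y. measure_pmf.expectation (Pi_pmf A d p) (\<lambda>h. f (h(x := y))))"
  using assms
  by (simp add: Pi_pmf_insert expectation_pair_pmf_finite finite_set_Pi_pmf)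

section \<open>Recursion, monotonicity and continuity for Bernoulli sums\<close>

abbreviation bernoulli_sum_exp :: "nat set \<Rightarrow> (nat \<Rightarrow> real) \<Rightarrow> (nat \<Rightarrow> real) \<Rightarrow> real" where
  "bernoulli_sum_exp I q g \<equiv> measure_pmf.expectation (bernoulli_sum_pmf I q) g"

lemma bernoulli_sum_exp_eq:
  "bernoulli_sum_exp I q g =
    measure_pmf.expectation (Pi_pmf I False (\<lambda>i. bernoulli_pmf (q i)))
      (\<lambda>x. g (\<Sum>i\<in>I. of_bool (x i)))"
  by (simp add: bernoulli_sum_pmf_def)

lemma bernoulli_sum_exp_empty [simp]: "bernoulli_sum_exp {} q g = g 0"
  by (simp add: bernoulli_sum_exp_eq)

lemma finite_set_bernoulli_sum_pmf: "finite I \<Longrightarrow> finite (set_pmf (bernoulli_sum_pmf I q))"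
  by (simp add: bernoulli_sum_pmf_def finite_set_Pi_pmf)

text \<open>Condition on the variable with index \<open>x\<close>. The shifted function on the right
  is why the monotonicity and continuity inductions keep \<open>g\<close> arbitrary.\<close>

lemma bernoulli_sum_exp_insert:
  assumes "finite I" "x \<notin> I" "q x \<in> {0..1}"
  shows "bernoulli_sum_exp (insert x I) q g =
    q x * bernoulli_sum_exp I q (\<lambda>s. g (Suc s)) + (1 - q x) * bernoulli_sum_exp I q g"
proof -
  have upd: "(\<Sum>i\<in>insert x I. of_bool ((h(x := y)) i)) = of_bool y + (\<Sum>i\<in>I. of_bool (h i) :: nat)"
    for h y
  proof -
    have "(\<Sum>i\<in>I. of_bool ((h(x := y)) i) :: nat) = (\<Sum>i\<in>I. of_bool (h i))"
      using assms(2) by (intro sum.cong) auto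
    then show ?thesis
      by (simp only: sum.insert[OF assms(1,2)] fun_upd_same)
  qed
  show ?thesis
    unfolding bernoulli_sum_exp_eq using assms
    by (subst expectation_Pi_pmf_insert) (simp_all only: upd, auto simp: mult.commute)
qed

lemma bernoulli_sum_exp_Suc:
  assumes "q (Suc n) \<in> {0..1}"
  shows "bernoulli_sum_exp {1..Suc n} q g =
    q (Suc n) * bernoulli_sum_exp {1..n} q (\<lambda>s. g (Suc s))
      + (1 - q (Suc n)) * bernoulli_sum_exp {1..n} q g"
  using bernoulli_sum_exp_insert[of "{1..n}" "Suc n" q g] assms
  by (simp add: atLeastAtMostSuc_conv)

lemma bernoulli_sum_pmf_cong:
  "(\<And>i. i \<in> I \<Longrightarrow> q i = q' i) \<Longrightarrow> bernoulli_sum_pmf I q = bernoulli_sum_pmf I q'"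
  unfolding bernoulli_sum_pmf_def by (metis (mono_tags, lifting) Pi_pmf_cong)

lemma bernoulli_sum_exp_mono_fun:
  assumes "finite I" "\<And>s. g s \<le> h s"
  shows "bernoulli_sum_exp I q g \<le> bernoulli_sum_exp I q h"
  using assms by (intro integral_mono integrable_measure_pmf_finite finite_set_bernoulli_sum_pmf)

text \<open>Raise the means in two stages: those in \<open>I\<close> by induction, in both branches
  of the recursion, then that of \<open>x\<close>.\<close>

lemma bernoulli_sum_exp_mono:
  fixes g :: "nat \<Rightarrow> real"
  assumes "finite I" "\<And>i. i \<in> I \<Longrightarrow> 0 \<le> q i \<and> q i \<le> q' i \<and> q' i \<le> 1" "mono g"
  shows "bernoulli_sum_exp I q g \<le> bernoulli_sum_exp I q' g"
  using assms
proof (induction I arbitrary: g rule: finite_induct)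
  case (insert x I)
  let ?E = "bernoulli_sum_exp I q"
  let ?E' = "bernoulli_sum_exp I q'"
  have qx: "0 \<le> q x" "q x \<le> q' x" "q' x \<le> 1"
    using insert.prems(1)[of x] by auto
  \<comment> \<open>Monotone \<open>g\<close> makes the success branch the better one, so moving
    weight \<open>q' x - q x\<close> to it cannot lower the expectation.\<close>
  have "?E' g \<le> ?E' (\<lambda>s. g (Suc s))"
    using insert.hyps insert.prems(2) by (intro bernoulli_sum_exp_mono_fun) (auto simp: mono_def)
  then have "0 \<le> (q' x - q x) * (?E' (\<lambda>s. g (Suc s)) - ?E' g)"
    using qx by simp
  then have "q x * ?E' (\<lambda>s. g (Suc s)) + (1 - q x) * ?E' g
      \<le> q' x * ?E' (\<lambda>s. g (Suc s)) + (1 - q' x) * ?E' g"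
    by (simp add: algebra_simps)
  moreover have "?E g \<le> ?E' g" "?E (\<lambda>s. g (Suc s)) \<le> ?E' (\<lambda>s. g (Suc s))"
    using insert.prems by (auto intro!: insert.IH simp: mono_def)
  then have "q x * ?E (\<lambda>s. g (Suc s)) + (1 - q x) * ?E g
      \<le> q x * ?E' (\<lambda>s. g (Suc s)) + (1 - q x) * ?E' g"
    using qx by (intro add_mono mult_left_mono) auto
  ultimately show ?case
    using insert.hyps qx by (simp add: bernoulli_sum_exp_insert)
qed simp

lemma bernoulli_sum_exp_0:
  assumes "finite I" "\<And>i. i \<in> I \<Longrightarrow> q i = 0"
  shows "bernoulli_sum_exp I q g = g 0"
  using assms by (induction I rule: finite_induct) (auto simp: bernoulli_sum_exp_insert)

lemma bernoulli_sum_exp_1: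
  assumes "finite I" "\<And>i. i \<in> I \<Longrightarrow> q i = 1"
  shows "bernoulli_sum_exp I q g = g (card I)"
  using assms by (induction I arbitrary: g rule: finite_induct) (auto simp: bernoulli_sum_exp_insert)

text \<open>By the recursion the expectation is a polynomial in finitely many coordinates of
  \<open>q\<close>, and coordinates are continuous in the product topology.\<close>

lemma continuous_on_bernoulli_sum_exp:
  assumes "finite I" "\<And>q i. q \<in> S \<Longrightarrow> i \<in> I \<Longrightarrow> q i \<in> {0..1}"
  shows "continuous_on S (\<lambda>q. bernoulli_sum_exp I q g)"
  using assms
proof (induction I arbitrary: g rule: finite_induct)
  case (insert x I)
  have "continuous_on S (\<lambda>q. q x * bernoulli_sum_exp I q (\<lambda>s. g (Suc s))
      + (1 - q x) * bernoulli_sum_exp I q g)"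
    using insert.prems
    by (intro continuous_intros insert.IH continuous_on_subset[OF continuous_on_product_coordinates]) auto
  then show ?case
    using insert.hyps insert.prems
    by (subst continuous_on_cong[OF refl bernoulli_sum_exp_insert]) auto
qed simp

section \<open>Free-slot probability and expected number of filled slots\<close>

definition vacancy :: "nat \<Rightarrow> nat \<Rightarrow> (nat \<Rightarrow> real) \<Rightarrow> real" where
  "vacancy k n q = bernoulli_sum_exp {1..n} q (\<lambda>s. of_bool (s < k))"

text \<open>Let \<open>q i\<close> be the chance that agent \<open>i\<close> is wanted. Acceptance
  stops at \<open>k\<close>, hence the truncation; \<open>vacancy k n q\<close> is then the chance
  that agent \<open>Suc n\<close> still finds a slot.\<close>

definition fill :: "nat \<Rightarrow> nat \<Rightarrow> (nat \<Rightarrow> real) \<Rightarrow> real" where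
  "fill k n q = bernoulli_sum_exp {1..n} q (\<lambda>s. real (min s k))"

lemma prob_eq_vacancy:
  "measure_pmf.prob (bernoulli_sum_pmf {1..n} q) {s. s < k} = vacancy k n q"
proof -
  have "(\<lambda>s. of_bool (s < k)) = (indicator {s. s < k} :: nat \<Rightarrow> real)"
    by (auto simp: indicator_def fun_eq_iff)
  then show ?thesis
    by (simp add: vacancy_def)
qed

lemma feasible_values_altdef:
  "feasible_values k n = {\<alpha>. \<exists>q. (\<forall>i\<in>{1..n - 1}. q i \<in> {0..1}) \<and>
     \<alpha> = vacancy k (n - 1) q \<and> \<alpha> = fill k (n - 1) q / real k}"
  unfolding feasible_values_def prob_eq_vacancy fill_def by simp

text \<open>Agent \<open>Suc n\<close> fills a slot when it is wanted and fewer than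
  \<open>k\<close> of its predecessors were; these two events are independent.\<close>

lemma fill_Suc:
  assumes "q (Suc n) \<in> {0..1}"
  shows "fill k (Suc n) q = fill k n q + vacancy k n q * q (Suc n)"
proof -
  let ?E = "bernoulli_sum_exp {1..n} q"
  have "(\<lambda>s. real (min (Suc s) k)) = (\<lambda>s. real (min s k) + of_bool (s < k))"
    by (auto simp: fun_eq_iff)
  then have "?E (\<lambda>s. real (min (Suc s) k)) = fill k n q + vacancy k n q"
    unfolding fill_def vacancy_def
    by (simp add: integrable_measure_pmf_finite finite_set_bernoulli_sum_pmf)
  then show ?thesis
    unfolding fill_def bernoulli_sum_exp_Suc[of q, OF assms]
    by (simp add: algebra_simps fill_def)
qed

lemma fill_eq_sum:
  assumes "\<And>i. i \<in> {1..n} \<Longrightarrow> q i \<in> {0..1}"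
  shows "fill k n q = (\<Sum>i\<in>{1..n}. vacancy k (i - 1) q * q i)"
  using assms
proof (induction n)
  case (Suc n)
  then show ?case
    by (subst fill_Suc) auto
qed (simp add: fill_def)

lemma vacancy_bounds: "0 \<le> vacancy k n q" "vacancy k n q \<le> 1"
  unfolding prob_eq_vacancy[symmetric] by simp_all

lemma fill_nonneg: "0 \<le> fill k n q"
  unfolding fill_def by simp

lemma fill_le: "fill k n q \<le> real k"
  unfolding fill_def using bernoulli_sum_exp_mono_fun[of "{1..n}" "\<lambda>s. real (min s k)" "\<lambda>_. real k" q] by simp

lemma vacancy_antimono:
  assumes "\<And>i. i \<in> {1..n} \<Longrightarrow> 0 \<le> q i \<and> q i \<le> q' i \<and> q' i \<le> 1"
  shows "vacancy k n q' \<le> vacancy k n q"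
  using bernoulli_sum_exp_mono[of "{1..n}" q q' "\<lambda>s. - of_bool (s < k)"] assms
  by (auto simp: vacancy_def mono_def)

lemma fill_mono:
  assumes "\<And>i. i \<in> {1..n} \<Longrightarrow> 0 \<le> q i \<and> q i \<le> q' i \<and> q' i \<le> 1"
  shows "fill k n q \<le> fill k n q'"
  unfolding fill_def using assms by (intro bernoulli_sum_exp_mono) (auto simp: mono_def)

lemma vacancy_Suc_le:
  assumes "q (Suc n) \<in> {0..1}"
  shows "vacancy k (Suc n) q \<le> vacancy k n q"
proof -
  have "bernoulli_sum_exp {1..n} q (\<lambda>s. of_bool (Suc s < k)) \<le> vacancy k n q"
    unfolding vacancy_def by (intro bernoulli_sum_exp_mono_fun) auto
  then have "q (Suc n) * bernoulli_sum_exp {1..n} q (\<lambda>s. of_bool (Suc s < k))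
      \<le> q (Suc n) * vacancy k n q"
    using assms by (intro mult_left_mono) auto
  then show ?thesis
    unfolding vacancy_def bernoulli_sum_exp_Suc[of q, OF assms] by (simp add: vacancy_def algebra_simps)
qed

lemma vacancy_antimono_agents:
  assumes "j \<le> n" "\<And>i. i \<in> {1..n} \<Longrightarrow> q i \<in> {0..1}"
  shows "vacancy k n q \<le> vacancy k j q"
  using assms
proof (induction n rule: dec_induct)
  case (step n)
  then show ?case
    using vacancy_Suc_le[of q n k] by force
qed simp

lemma continuous_on_vacancy_fill:
  assumes "\<And>q i. q \<in> S \<Longrightarrow> i \<in> {1..n} \<Longrightarrow> q i \<in> {0..1}"
  shows "continuous_on S (vacancy k n)" "continuous_on S (fill k n)"
  unfolding vacancy_def[abs_def] fill_def[abs_def]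
  using assms by (auto intro!: continuous_on_bernoulli_sum_exp)

section \<open>Compactness and existence of the minimum\<close>

lemma compact_unit_cube: "compact {q :: nat \<Rightarrow> real. \<forall>i. q i \<in> {0..1}}"
proof -
  have "compactin (product_topology (\<lambda>_. euclidean) UNIV) (\<Pi>\<^sub>E i\<in>(UNIV :: nat set). {0..1 :: real})"
    by (simp add: compactin_PiE)
  moreover have "(\<Pi>\<^sub>E i\<in>(UNIV :: nat set). {0..1 :: real}) = {q. \<forall>i. q i \<in> {0..1}}"
    by (auto simp: PiE_def Pi_def)
  ultimately show ?thesis
    by (simp add: euclidean_product_topology)
qed

text \<open>The feasible values are the continuous image of a closed subset of the compact cube.
  Balanced policies later show that there are any.\<close>

lemma feasible_values_attains_min:
  assumes "feasible_values k n \<noteq> {}"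
  obtains v where "v \<in> feasible_values k n" "\<forall>\<alpha>\<in>feasible_values k n. v \<le> \<alpha>"
proof -
  let ?C = "{q :: nat \<Rightarrow> real. \<forall>i. q i \<in> {0..1}}"
  let ?h = "\<lambda>q. vacancy k (n - 1) q - fill k (n - 1) q / real k"
  let ?K = "{q \<in> ?C. ?h q = 0}"
  have cont: "continuous_on ?C (vacancy k (n - 1))" "continuous_on ?C (fill k (n - 1))"
    by (rule continuous_on_vacancy_fill; simp)+
  have eq: "feasible_values k n = vacancy k (n - 1) ` ?K"
  proof (intro equalityI subsetI)
    fix \<alpha> assume "\<alpha> \<in> feasible_values k n"
    then obtain q where q: "\<forall>i\<in>{1..n - 1}. q i \<in> {0..1}"
      "\<alpha> = vacancy k (n - 1) q" "\<alpha> = fill k (n - 1) q / real k"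
      unfolding feasible_values_altdef by auto
    \<comment> \<open>Feasibility constrains only the coordinates up to \<open>n - 1\<close>;
      setting the others to 0 moves \<open>q\<close> into the cube without changing the sum.\<close>
    define q' where "q' i = (if i \<in> {1..n - 1} then q i else 0)" for i
    have "bernoulli_sum_pmf {1..n - 1} q' = bernoulli_sum_pmf {1..n - 1} q"
      by (rule bernoulli_sum_pmf_cong) (simp add: q'_def)
    then have "q' \<in> ?K" "vacancy k (n - 1) q' = \<alpha>"
      using q by (auto simp: vacancy_def fill_def q'_def)
    then show "\<alpha> \<in> vacancy k (n - 1) ` ?K"
      by blast
  next
    fix \<alpha> assume "\<alpha> \<in> vacancy k (n - 1) ` ?K"
    then obtain q where "\<forall>i. q i \<in> {0..1}" "?h q = 0" "\<alpha> = vacancy k (n - 1) q"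
      by blast
    then show "\<alpha> \<in> feasible_values k n"
      unfolding feasible_values_altdef by (intro CollectI exI[of _ q]) auto
  qed
  have "continuous_on ?C ?h"
    unfolding divide_inverse by (intro continuous_intros cont)
  moreover have "closed ?C"
    using compact_unit_cube compact_imp_closed by blast
  ultimately have "closed ?K"
    by (rule continuous_closed_preimage_constant)
  then have "compact ?K"
    using compact_Int_closed[OF compact_unit_cube, of ?K] by (simp add: Int_absorb1 Collect_mono_iff)
  then have "compact (feasible_values k n)"
    unfolding eq by (intro compact_continuous_image continuous_on_subset[OF cont(1)]) auto
  then show ?thesis
    using assms compact_attains_inf that by metis
qed

section \<open>The value of a static threshold policy\<close>

lemma expectation_swap_pmf_finite:
  fixes f :: "'a \<Rightarrow> 'b \<Rightarrow> real"
  assumes "finite (set_pmf p)" "finite (set_pmf q)"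
  shows "measure_pmf.expectation p (\<lambda>x. measure_pmf.expectation q (f x)) =
    measure_pmf.expectation q (\<lambda>y. measure_pmf.expectation p (\<lambda>x. f x y))"
proof -
  have "measure_pmf.expectation (pair_pmf p q) (\<lambda>(x, y). f x y) =
      measure_pmf.expectation (pair_pmf q p) (\<lambda>(y, x). f x y)"
    by (subst pair_commute_pmf) (simp add: case_prod_unfold)
  then show ?thesis
    using assms by (simp add: expectation_pair_pmf_finite)
qed

lemma expectation_add_pmf_finite:
  fixes f g :: "'a \<Rightarrow> real"
  assumes "finite (set_pmf p)"
  shows "measure_pmf.expectation p (\<lambda>x. f x + g x) =
    measure_pmf.expectation p f + measure_pmf.expectation p g"
  using assms by (simp add: integrable_measure_pmf_finite)

lemma expectation_affine_pmf_finite: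
  fixes f :: "'a \<Rightarrow> real"
  assumes "finite (set_pmf p)"
  shows "measure_pmf.expectation p (\<lambda>x. u + f x * v) = u + measure_pmf.expectation p f * v"
  using assms by (simp add: integrable_measure_pmf_finite)

lemma expectation_mono_pmf_finite:
  fixes f g :: "'a \<Rightarrow> real"
  assumes "finite (set_pmf p)" "\<And>x. x \<in> set_pmf p \<Longrightarrow> f x \<le> g x"
  shows "measure_pmf.expectation p f \<le> measure_pmf.expectation p g"
  using assms by (intro integral_mono_AE integrable_measure_pmf_finite) (auto simp: AE_measure_pmf_iff)

section \<open>Dynamics of a threshold policy\<close>

definition accepts :: "nat \<Rightarrow> nat \<Rightarrow> bool \<Rightarrow> bool" where
  "accepts J y b \<longleftrightarrow> y < J \<or> (y = J \<and> b)"

lemma accepted_Suc: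
  "accepted k J t c (Suc n) =
    (if card (accepted k J t c n) < k \<and> accepts J (t (Suc n)) (c (Suc n))
     then insert (Suc n) (accepted k J t c n) else accepted k J t c n)"
  by (simp add: accepts_def Let_def)

declare accepted.simps(2) [simp del]

lemma accepted_subset: "accepted k J t c n \<subseteq> {1..n}"
  by (induction n) (auto simp: accepted_Suc)

lemma finite_accepted [simp]: "finite (accepted k J t c n)"
  by (rule finite_subset[OF accepted_subset]) simp

lemma card_accepted_le: "card (accepted k J t c n) \<le> k"
proof (induction n)
  case (Suc n)
  have "Suc n \<notin> accepted k J t c n"
    using accepted_subset by fastforce
  then show ?case
    using Suc by (auto simp: accepted_Suc)
qed simp

lemma accepted_cong:
  assumes "\<And>i. i \<in> {1..n} \<Longrightarrow> t i = t' i" "\<And>i. i \<in> {1..n} \<Longrightarrow> c i = c' i"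
  shows "accepted k J t c n = accepted k J t' c' n"
  using assms
proof (induction n)
  case (Suc n)
  then have "accepted k J t c n = accepted k J t' c' n" "t (Suc n) = t' (Suc n)"
    "c (Suc n) = c' (Suc n)"
    by auto
  then show ?case
    by (simp only: accepted_Suc)
qed simp

text \<open>The type laws \<open>p\<close> are arbitrary so that inductions on \<open>n\<close> need
  only finite supports; \<open>ALG\<close> uses the instance \<open>type_pmf m G\<close>.\<close>

definition arrivals_pmf :: "nat \<Rightarrow> (nat \<Rightarrow> nat pmf) \<Rightarrow> real \<Rightarrow> ((nat \<Rightarrow> nat) \<times> (nat \<Rightarrow> bool)) pmf" where
  "arrivals_pmf n p \<rho> =
     pair_pmf (Pi_pmf {1..n} 0 p) (Pi_pmf {1..n} False (\<lambda>_. bernoulli_pmf \<rho>))"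

lemma finite_set_arrivals_pmf:
  assumes "\<And>i. i \<in> {1..n} \<Longrightarrow> finite (set_pmf (p i))"
  shows "finite (set_pmf (arrivals_pmf n p \<rho>))"
  unfolding arrivals_pmf_def set_pair_pmf
  using assms by (intro finite_cartesian_product finite_set_Pi_pmf) auto

lemma expectation_arrivals_Suc:
  fixes f :: "(nat \<Rightarrow> nat) \<Rightarrow> (nat \<Rightarrow> bool) \<Rightarrow> real"
  assumes "\<And>i. i \<in> {1..Suc n} \<Longrightarrow> finite (set_pmf (p i))"
  shows "measure_pmf.expectation (arrivals_pmf (Suc n) p \<rho>) (\<lambda>(t, c). f t c) =
    measure_pmf.expectation (pair_pmf (p (Suc n)) (bernoulli_pmf \<rho>))
      (\<lambda>(y, b). measure_pmf.expectation (arrivals_pmf n p \<rho>)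
        (\<lambda>(t, c). f (t(Suc n := y)) (c(Suc n := b))))"
proof -
  have fin: "finite (set_pmf (p (Suc n)))" "finite (set_pmf (Pi_pmf {1..n} 0 p))"
    "finite (set_pmf (Pi_pmf {1..n} False (\<lambda>_. bernoulli_pmf \<rho>)))"
    "finite (set_pmf (Pi_pmf (insert (Suc n) {1..n}) 0 p))"
    "finite (set_pmf (Pi_pmf (insert (Suc n) {1..n}) False (\<lambda>_. bernoulli_pmf \<rho>)))"
    using assms by (auto intro!: finite_set_Pi_pmf)
  have ins: "{1..Suc n} = insert (Suc n) {1..n}"
    by auto
  have insP: "measure_pmf.expectation (Pi_pmf (insert (Suc n) {1..n}) 0 p) g =
      measure_pmf.expectation (p (Suc n))
        (\<lambda>y. measure_pmf.expectation (Pi_pmf {1..n} 0 p) (\<lambda>h. g (h(Suc n := y))))"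
    for g :: "(nat \<Rightarrow> nat) \<Rightarrow> real"
    by (rule expectation_Pi_pmf_insert) (use assms in auto)
  have insB: "measure_pmf.expectation (Pi_pmf (insert (Suc n) {1..n}) False (\<lambda>_. bernoulli_pmf \<rho>)) g =
      measure_pmf.expectation (bernoulli_pmf \<rho>)
        (\<lambda>b. measure_pmf.expectation (Pi_pmf {1..n} False (\<lambda>_. bernoulli_pmf \<rho>))
          (\<lambda>h. g (h(Suc n := b))))"
    for g :: "(nat \<Rightarrow> bool) \<Rightarrow> real"
    by (rule expectation_Pi_pmf_insert) auto
  have "measure_pmf.expectation (arrivals_pmf (Suc n) p \<rho>) (\<lambda>(t, c). f t c) =
    measure_pmf.expectation (p (Suc n)) (\<lambda>y. measure_pmf.expectation (Pi_pmf {1..n} 0 p) (\<lambda>t.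
      measure_pmf.expectation (bernoulli_pmf \<rho>) (\<lambda>b.
        measure_pmf.expectation (Pi_pmf {1..n} False (\<lambda>_. bernoulli_pmf \<rho>))
          (\<lambda>c. f (t(Suc n := y)) (c(Suc n := b))))))"
    unfolding arrivals_pmf_def ins using fin
    by (simp add: expectation_pair_pmf_finite insP insB del: One_nat_def)
  \<comment> \<open>Move the coin of agent \<open>Suc n\<close> outside the types of the earlier
    agents.\<close>
  also have "\<dots> = measure_pmf.expectation (p (Suc n)) (\<lambda>y.
      measure_pmf.expectation (bernoulli_pmf \<rho>) (\<lambda>b.
        measure_pmf.expectation (Pi_pmf {1..n} 0 p) (\<lambda>t.
          measure_pmf.expectation (Pi_pmf {1..n} False (\<lambda>_. bernoulli_pmf \<rho>))
            (\<lambda>c. f (t(Suc n := y)) (c(Suc n := b))))))"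
    by (simp only: expectation_swap_pmf_finite[of "Pi_pmf {1..n} 0 p" "bernoulli_pmf \<rho>", OF fin(2) finite])
  finally show ?thesis
    unfolding arrivals_pmf_def using fin by (simp add: expectation_pair_pmf_finite del: One_nat_def)
qed

text \<open>These become the means of the Bernoulli sums: whether an agent is wanted depends only on
  its own type and coin.\<close>

definition accept_prob :: "(nat \<Rightarrow> nat pmf) \<Rightarrow> nat \<Rightarrow> real \<Rightarrow> nat \<Rightarrow> real" where
  "accept_prob p J \<rho> i = measure_pmf.expectation (pair_pmf (p i) (bernoulli_pmf \<rho>))
     (\<lambda>(y, b). of_bool (accepts J y b))"

lemma accept_prob_in_unit: "accept_prob p J \<rho> i \<in> {0..1}"
proof -
  have "accept_prob p J \<rho> i =
      measure_pmf.prob (pair_pmf (p i) (bernoulli_pmf \<rho>)) {(y, b). accepts J y b}"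
  proof -
    have "(\<lambda>(y, b). of_bool (accepts J y b)) = (indicator {(y, b). accepts J y b} :: _ \<Rightarrow> real)"
      by (auto simp: fun_eq_iff indicator_def)
    then show ?thesis
      by (simp add: accept_prob_def)
  qed
  then show ?thesis
    by simp
qed

text \<open>Wanted agents are accepted until \<open>k\<close> are in, so the number accepted is
  distributed as a Bernoulli sum truncated at \<open>k\<close>.\<close>

lemma expectation_card_accepted:
  fixes g :: "nat \<Rightarrow> real"
  assumes "\<And>i. i \<in> {1..n} \<Longrightarrow> finite (set_pmf (p i))"
  shows "measure_pmf.expectation (arrivals_pmf n p \<rho>) (\<lambda>(t, c). g (card (accepted k J t c n))) =
    bernoulli_sum_exp {1..n} (accept_prob p J \<rho>) (\<lambda>s. g (min s k))"
  using assms
proof (induction n arbitrary: g)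
  case 0
  then show ?case
    by (simp add: arrivals_pmf_def)
next
  case (Suc n)
  let ?q = "accept_prob p J \<rho>"
  let ?E = "bernoulli_sum_exp {1..n} ?q"
  let ?W = "measure_pmf.expectation (arrivals_pmf n p \<rho>)"
  have step: "card (accepted k J (t(Suc n := y)) (c(Suc n := b)) (Suc n)) =
      (if accepts J y b then min (Suc (card (accepted k J t c n))) k else card (accepted k J t c n))"
    for t c y b
  proof -
    have "accepted k J (t(Suc n := y)) (c(Suc n := b)) n = accepted k J t c n"
      by (rule accepted_cong) auto
    moreover have "Suc n \<notin> accepted k J t c n"
      using accepted_subset by fastforce
    ultimately show ?thesis
      using card_accepted_le[of k J t c n] by (auto simp: accepted_Suc)
  qed
  \<comment> \<open>Written affinely in the indicator of acceptance, so that averaging over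
    \<open>(y, b)\<close> merely replaces that indicator by \<open>?q (Suc n)\<close>.\<close>
  have inner: "?W (\<lambda>(t, c). g (card (accepted k J (t(Suc n := y)) (c(Suc n := b)) (Suc n)))) =
      ?E (\<lambda>s. g (min s k))
        + of_bool (accepts J y b) * (?E (\<lambda>s. g (min (Suc s) k)) - ?E (\<lambda>s. g (min s k)))" for y b
  proof (cases "accepts J y b")
    case True
    have "?W (\<lambda>(t, c). g (min (Suc (card (accepted k J t c n))) k)) = ?E (\<lambda>s. g (min (Suc (min s k)) k))"
      using Suc.prems by (intro Suc.IH[of "\<lambda>s. g (min (Suc s) k)"]) auto
    moreover have "min (Suc (min s k)) k = min (Suc s) k" for s
      by auto
    ultimately show ?thesis
      unfolding step using True by simp
  next
    case False
    then show ?thesis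
      unfolding step using Suc.IH[of g] Suc.prems by simp
  qed
  have fin: "finite (set_pmf (pair_pmf (p (Suc n)) (bernoulli_pmf \<rho>)))"
    using Suc.prems by simp
  have "measure_pmf.expectation (arrivals_pmf (Suc n) p \<rho>) (\<lambda>(t, c). g (card (accepted k J t c (Suc n)))) =
      ?E (\<lambda>s. g (min s k)) + ?q (Suc n) * (?E (\<lambda>s. g (min (Suc s) k)) - ?E (\<lambda>s. g (min s k)))"
    by (subst expectation_arrivals_Suc[OF Suc.prems], assumption, unfold inner accept_prob_def[of _ _ _ "Suc n"])
      (simp only: case_prod_unfold expectation_affine_pmf_finite[OF fin])
  then show ?case
    unfolding bernoulli_sum_exp_Suc[of ?q, OF accept_prob_in_unit] by (simp add: algebra_simps)
qed

text \<open>Whether a slot is free for agent \<open>i\<close> depends on earlier arrivals only,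
  hence is independent of its type and coin, and its expected contribution factorises.\<close>

lemma expectation_value_accepted:
  fixes r :: "nat \<Rightarrow> real"
  assumes "\<And>i. i \<in> {1..n} \<Longrightarrow> finite (set_pmf (p i))"
  shows "measure_pmf.expectation (arrivals_pmf n p \<rho>) (\<lambda>(t, c). \<Sum>i\<in>accepted k J t c n. r (t i)) =
    (\<Sum>i\<in>{1..n}. vacancy k (i - 1) (accept_prob p J \<rho>) *
      measure_pmf.expectation (pair_pmf (p i) (bernoulli_pmf \<rho>))
        (\<lambda>(y, b). of_bool (accepts J y b) * r y))"
  using assms
proof (induction n)
  case 0
  then show ?case
    by (simp add: arrivals_pmf_def)
next
  case (Suc n)
  let ?W = "measure_pmf.expectation (arrivals_pmf n p \<rho>)"
  let ?V = "\<lambda>n t c. \<Sum>i\<in>accepted k J t c n. r (t i)"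
  have step: "?V (Suc n) (t(Suc n := y)) (c(Suc n := b)) =
      ?V n t c + of_bool (accepts J y b) * r y * of_bool (card (accepted k J t c n) < k)"
    for t c y b
  proof -
    have "accepted k J (t(Suc n := y)) (c(Suc n := b)) n = accepted k J t c n"
      by (rule accepted_cong) auto
    moreover have notin: "Suc n \<notin> accepted k J t c n"
      using accepted_subset by fastforce
    moreover have "(\<Sum>i\<in>accepted k J t c n. r ((t(Suc n := y)) i)) = ?V n t c"
      using notin by (intro sum.cong) auto
    ultimately show ?thesis
      by (auto simp: accepted_Suc)
  qed
  have finW: "finite (set_pmf (arrivals_pmf n p \<rho>))"
    using Suc.prems by (intro finite_set_arrivals_pmf) auto
  \<comment> \<open>Truncating at \<open>k\<close> does not affect whether the count is below
    \<open>k\<close>.\<close>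
  have "?W (\<lambda>(t, c). of_bool (card (accepted k J t c n) < k)) = vacancy k n (accept_prob p J \<rho>)"
    using expectation_card_accepted[of n p \<rho> "\<lambda>s. of_bool (s < k)" k J] Suc.prems
    by (simp add: vacancy_def min_less_iff_disj)
  then have inner: "?W (\<lambda>(t, c). ?V (Suc n) (t(Suc n := y)) (c(Suc n := b))) =
      ?W (\<lambda>(t, c). ?V n t c)
        + of_bool (accepts J y b) * r y * vacancy k n (accept_prob p J \<rho>)" for y b
    unfolding step by (simp add: case_prod_unfold expectation_add_pmf_finite[OF finW])
  have fin: "finite (set_pmf (pair_pmf (p (Suc n)) (bernoulli_pmf \<rho>)))"
    using Suc.prems by simp
  have "measure_pmf.expectation (arrivals_pmf (Suc n) p \<rho>) (\<lambda>(t, c). ?V (Suc n) t c) =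
      ?W (\<lambda>(t, c). ?V n t c) + measure_pmf.expectation (pair_pmf (p (Suc n)) (bernoulli_pmf \<rho>))
        (\<lambda>(y, b). of_bool (accepts J y b) * r y) * vacancy k n (accept_prob p J \<rho>)"
    by (subst expectation_arrivals_Suc[OF Suc.prems], assumption, unfold inner)
      (simp only: case_prod_unfold expectation_affine_pmf_finite[OF fin])
  then show ?case
    using Suc by simp
qed

section \<open>Type distributions and acceptance probabilities\<close>

lemma expectation_type_pmf:
  assumes "type_dists n m G" "i \<in> {1..n}"
  shows "measure_pmf.expectation (type_pmf m G i) f = (\<Sum>j\<in>{1..m}. type_prob G i j * f j)"
    and "set_pmf (type_pmf m G i) \<subseteq> {1..m}"
proof -
  show *: "set_pmf (type_pmf m G i) \<subseteq> {1..m}"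
    by (auto simp: set_pmf_eq pmf_type_pmf[OF assms])
  show "measure_pmf.expectation (type_pmf m G i) f = (\<Sum>j\<in>{1..m}. type_prob G i j * f j)"
    by (subst integral_measure_pmf_real[of "{1..m}"]) (use * in \<open>auto simp: pmf_type_pmf[OF assms] mult.commute\<close>)
qed

lemma finite_set_type_pmf:
  assumes "type_dists n m G" "i \<in> {1..n}"
  shows "finite (set_pmf (type_pmf m G i))"
  using expectation_type_pmf(2)[OF assms] finite_subset by blast

lemma type_prob_nonneg:
  assumes "type_dists n m G" "i \<in> {1..n}" "j \<in> {1..m}"
  shows "0 \<le> type_prob G i j"
  using assms by (auto simp: type_dists_def type_prob_def)

lemma sum_type_prob_upto:
  assumes "type_dists n m G" "i \<in> {1..n}"
  shows "(\<Sum>j\<in>{1..l}. type_prob G i j) = G i l"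
  using assms by (induction l) (auto simp: type_prob_def type_dists_def)

abbreviation policy_prob :: "nat \<Rightarrow> (nat \<Rightarrow> nat \<Rightarrow> real) \<Rightarrow> nat \<Rightarrow> real \<Rightarrow> nat \<Rightarrow> real" where
  "policy_prob m G \<equiv> accept_prob (type_pmf m G)"

lemma policy_prob_eq:
  assumes "type_dists n m G" "i \<in> {1..n}" "J \<in> {1..m}" "\<rho> \<in> {0..1}"
  shows "policy_prob m G J \<rho> i = G i (J - 1) + \<rho> * type_prob G i J"
proof -
  have "policy_prob m G J \<rho> i = (\<Sum>j\<in>{1..m}. type_prob G i j * (of_bool (j < J) + \<rho> * of_bool (j = J)))"
    unfolding accept_prob_def using assms
    by (simp add: expectation_pair_pmf_finite finite_set_type_pmf expectation_type_pmf accepts_def)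
      (auto intro!: sum.cong simp: algebra_simps)
  also have "\<dots> = (\<Sum>j\<in>{1..m}. if j < J then type_prob G i j else 0)
      + (\<Sum>j\<in>{1..m}. if j = J then \<rho> * type_prob G i j else 0)"
    unfolding sum.distrib[symmetric] by (intro sum.cong) auto
  also have "(\<Sum>j\<in>{1..m}. if j < J then type_prob G i j else 0) = (\<Sum>j\<in>{1..J - 1}. type_prob G i j)"
    using assms(3) by (intro sum.mono_neutral_cong_right) auto
  also have "\<dots> = G i (J - 1)"
    by (rule sum_type_prob_upto[OF assms(1,2)])
  also have "(\<Sum>j\<in>{1..m}. if j = J then \<rho> * type_prob G i j else 0) = \<rho> * type_prob G i J"
    using assms(3) by simp
  finally show ?thesis .
qed

lemma ALG_eq:
  assumes "type_dists n m G"
  shows "ALG k n m G J \<rho> r =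
    (\<Sum>i\<in>{1..n}. vacancy k (i - 1) (policy_prob m G J \<rho>) *
      measure_pmf.expectation (pair_pmf (type_pmf m G i) (bernoulli_pmf \<rho>))
        (\<lambda>(y, b). of_bool (accepts J y b) * r y))"
proof -
  have "ALG k n m G J \<rho> r = measure_pmf.expectation (arrivals_pmf n (type_pmf m G) \<rho>)
      (\<lambda>(t, c). \<Sum>i\<in>accepted k J t c n. r (t i))"
    by (simp only: ALG_def types_pmf_def arrivals_pmf_def)
  then show ?thesis
    using expectation_value_accepted[OF finite_set_type_pmf[OF assms]] by simp
qed

lemma ALG_const:
  assumes "type_dists n m G"
  shows "ALG k n m G J \<rho> (\<lambda>_. 1) = fill k n (policy_prob m G J \<rho>)"
  unfolding ALG_eq[OF assms] fill_eq_sum[OF accept_prob_in_unit]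
  by (intro sum.cong refl arg_cong2[where f = "(*)"]) (simp add: accept_prob_def)

section \<open>Benchmarks and guarantees\<close>

lemma valuations_nonneg: "valuations m r \<Longrightarrow> j \<in> {1..m} \<Longrightarrow> 0 \<le> r j"
  by (simp add: valuations_def)

lemma valuations_antimono:
  assumes "valuations m r" "i \<le> j" "1 \<le> i" "j \<le> m"
  shows "r j \<le> r i"
  using assms(2,4)
proof (induction j rule: dec_induct)
  case (step j)
  then have "r (j + 1) \<le> r j"
    using assms(1,3) by (auto simp: valuations_def)
  then show ?case
    using step by simp
qed simp

lemma sum_type_prob:
  assumes "type_dists n m G" "i \<in> {1..n}"
  shows "(\<Sum>j\<in>{1..m}. type_prob G i j) = 1"
  unfolding sum_type_prob_upto[OF assms] using assms by (auto simp: type_dists_def)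

lemma expectation_types_pmf:
  assumes "type_dists n m G" "i \<in> {1..n}"
  shows "measure_pmf.expectation (types_pmf n m G) (\<lambda>t. h (t i)) = (\<Sum>j\<in>{1..m}. type_prob G i j * h j)"
proof -
  have "measure_pmf.expectation (types_pmf n m G) (\<lambda>t. h (t i)) =
      measure_pmf.expectation (map_pmf (\<lambda>t. t i) (types_pmf n m G)) h"
    by simp
  also have "map_pmf (\<lambda>t. t i) (types_pmf n m G) = type_pmf m G i"
    using assms(2) by (simp add: types_pmf_def Pi_pmf_component)
  finally show ?thesis
    by (simp add: expectation_type_pmf(1)[OF assms])
qed

lemma finite_set_types_pmf: "type_dists n m G \<Longrightarrow> finite (set_pmf (types_pmf n m G))"
  unfolding types_pmf_def by (intro finite_set_Pi_pmf finite_set_type_pmf) auto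

text \<open>The Lagrangian relaxation of the capacity constraint, with the value of type \<open>J\<close> as multiplier.\<close>

definition price_bound :: "nat \<Rightarrow> nat \<Rightarrow> nat \<Rightarrow> (nat \<Rightarrow> nat \<Rightarrow> real) \<Rightarrow> (nat \<Rightarrow> real) \<Rightarrow> nat \<Rightarrow> real" where
  "price_bound k n m G r J =
     real k * r J + (\<Sum>i\<in>{1..n}. \<Sum>j\<in>{1..m}. type_prob G i j * max 0 (r j - r J))"

text \<open>A selected value is at most the price \<open>r J\<close> plus its positive excess. At
  most \<open>k\<close> prices are paid, and letting every agent contribute its excess only
  increases the sum.\<close>

lemma Proph_le_price_bound:
  assumes G: "type_dists n m G" and "valuations m r" "J \<in> {1..m}"
  shows "Proph k n m G r \<le> price_bound k n m G r J"
proof -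
  have rJ: "0 \<le> r J"
    using assms by (simp add: valuations_nonneg)
  have "Max ((\<lambda>S. \<Sum>i\<in>S. r (t i)) ` {S. S \<subseteq> {1..n} \<and> card S \<le> k})
      \<le> real k * r J + (\<Sum>i\<in>{1..n}. max 0 (r (t i) - r J))" for t
  proof (rule Max.boundedI; safe?)
    fix S :: "nat set"
    assume S: "S \<subseteq> {1..n}" "card S \<le> k"
    have "(\<Sum>i\<in>S. r (t i)) \<le> (\<Sum>i\<in>S. r J + max 0 (r (t i) - r J))"
      by (intro sum_mono) auto
    also have "\<dots> = real (card S) * r J + (\<Sum>i\<in>S. max 0 (r (t i) - r J))"
      by (simp add: sum.distrib)
    also have "\<dots> \<le> real k * r J + (\<Sum>i\<in>{1..n}. max 0 (r (t i) - r J))"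
      using S rJ by (intro add_mono mult_right_mono sum_mono2) auto
    finally show "(\<Sum>i\<in>S. r (t i)) \<le> \<dots>" .
  qed auto
  then have "Proph k n m G r \<le> measure_pmf.expectation (types_pmf n m G)
      (\<lambda>t. real k * r J + (\<Sum>i\<in>{1..n}. max 0 (r (t i) - r J)))"
    unfolding Proph_def by (intro expectation_mono_pmf_finite finite_set_types_pmf[OF G])
  also have "\<dots> = real k * r J
      + (\<Sum>i\<in>{1..n}. measure_pmf.expectation (types_pmf n m G) (\<lambda>t. max 0 (r (t i) - r J)))"
    by (simp add: integrable_measure_pmf_finite finite_set_types_pmf[OF G])
  also have "\<dots> = price_bound k n m G r J"
    unfolding price_bound_def
    by (intro arg_cong2[where f = "(+)"] refl sum.cong expectation_types_pmf[OF G])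
  finally show ?thesis .
qed

text \<open>The prophet may in particular commit to \<open>S\<close> before seeing the
  types.\<close>

lemma Proph_ge_of_subset:
  assumes G: "type_dists n m G" and "S \<subseteq> {1..n}" "card S \<le> k"
  shows "measure_pmf.expectation (types_pmf n m G) (\<lambda>t. \<Sum>i\<in>S. r (t i)) \<le> Proph k n m G r"
  unfolding Proph_def using assms
  by (intro expectation_mono_pmf_finite finite_set_types_pmf[OF G] Max_ge) auto

lemma Proph_const_ge:
  assumes "type_dists n m G" "k < n"
  shows "real k \<le> Proph k n m G (\<lambda>_. 1)"
  using Proph_ge_of_subset[OF assms(1), of "{1..k}" k "\<lambda>_. 1"] assms by simp

text \<open>Commit to agent \<open>n\<close> alone. Constant and top-type valuations are the only
  ones the upper bound tests.\<close>

lemma Proph_top_ge: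
  assumes "type_dists n m G" "1 \<le> k" "k < n"
  shows "type_prob G n 1 \<le> Proph k n m G (\<lambda>j. of_bool (j = 1))"
proof -
  have "type_prob G n 1 = (\<Sum>j\<in>{1..m}. type_prob G n j * of_bool (j = 1))"
    using assms(1) by (simp add: type_dists_def of_bool_def if_distrib cong: if_cong)
  also have "\<dots> = measure_pmf.expectation (types_pmf n m G) (\<lambda>t. of_bool (t n = 1))"
    using assms by (intro expectation_types_pmf[symmetric]) auto
  also have "\<dots> = measure_pmf.expectation (types_pmf n m G) (\<lambda>t. \<Sum>i\<in>{n}. of_bool (t i = 1))"
    by (simp del: sum_of_bool_eq)
  also have "\<dots> \<le> Proph k n m G (\<lambda>j. of_bool (j = 1))"
    using assms by (intro Proph_ge_of_subset) auto
  finally show ?thesis .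
qed

text \<open>Weak duality: the splitting used for the prophet, with expected counts
  \<open>a j\<close> in place of selected agents.\<close>

lemma ExAnte_feasible_le_price_bound:
  assumes "valuations m r" "J \<in> {1..m}"
    and a: "(\<Sum>j\<in>{1..m}. a j) \<le> real k"
      "\<forall>j\<in>{1..m}. 0 \<le> a j \<and> a j \<le> (\<Sum>i\<in>{1..n}. type_prob G i j)"
  shows "(\<Sum>j\<in>{1..m}. r j * a j) \<le> price_bound k n m G r J"
proof -
  have rJ: "0 \<le> r J"
    using assms by (simp add: valuations_nonneg)
  have "(\<Sum>j\<in>{1..m}. r j * a j) \<le> (\<Sum>j\<in>{1..m}. r J * a j + max 0 (r j - r J) * a j)"
    using a by (intro sum_mono) (auto simp: distrib_right[symmetric] intro!: mult_right_mono)
  also have "\<dots> = r J * (\<Sum>j\<in>{1..m}. a j) + (\<Sum>j\<in>{1..m}. max 0 (r j - r J) * a j)"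
    by (simp add: sum.distrib sum_distrib_left)
  also have "\<dots> \<le> r J * real k
      + (\<Sum>j\<in>{1..m}. max 0 (r j - r J) * (\<Sum>i\<in>{1..n}. type_prob G i j))"
    using a rJ by (intro add_mono mult_left_mono sum_mono) auto
  also have "\<dots> = price_bound k n m G r J"
    unfolding price_bound_def sum_distrib_left by (subst sum.swap) (simp add: mult.commute)
  finally show ?thesis .
qed

lemma ExAnte_le_price_bound:
  assumes G: "type_dists n m G" and r: "valuations m r" "J \<in> {1..m}"
  shows "ExAnte k n m G r \<le> price_bound k n m G r J"
  unfolding ExAnte_def
proof (rule cSup_least)
  have "\<exists>a. (\<Sum>j\<in>{1..m}. a j) \<le> real k \<and>
      (\<forall>j\<in>{1..m}. 0 \<le> a j \<and> a j \<le> (\<Sum>i\<in>{1..n}. type_prob G i j))"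
    using type_prob_nonneg[OF G] by (intro exI[of _ "\<lambda>_. 0"]) (auto intro!: sum_nonneg)
  then show "{(\<Sum>j\<in>{1..m}. r j * a j) | a. (\<Sum>j\<in>{1..m}. a j) \<le> real k \<and>
      (\<forall>j\<in>{1..m}. 0 \<le> a j \<and> a j \<le> (\<Sum>i\<in>{1..n}. type_prob G i j))} \<noteq> {}"
    by blast
qed (use ExAnte_feasible_le_price_bound[OF r] in blast)

lemma ExAnte_ge_of_feasible:
  assumes G: "type_dists n m G" and r: "valuations m r"
    and a: "(\<Sum>j\<in>{1..m}. a j) \<le> real k"
      "\<And>j. j \<in> {1..m} \<Longrightarrow> 0 \<le> a j \<and> a j \<le> (\<Sum>i\<in>{1..n}. type_prob G i j)"
  shows "(\<Sum>j\<in>{1..m}. r j * a j) \<le> ExAnte k n m G r"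
  unfolding ExAnte_def
proof (rule cSup_upper)
  show "bdd_above {(\<Sum>j\<in>{1..m}. r j * a j) | a. (\<Sum>j\<in>{1..m}. a j) \<le> real k \<and>
      (\<forall>j\<in>{1..m}. 0 \<le> a j \<and> a j \<le> (\<Sum>i\<in>{1..n}. type_prob G i j))}"
    \<comment> \<open>With \<open>J = 1\<close> the duality bound dominates every feasible objective
      value.\<close>
    using G ExAnte_feasible_le_price_bound[OF r, of 1]
    by (intro bdd_aboveI[of _ "price_bound k n m G r 1"]) (auto simp: type_dists_def)
qed (use a in blast)

lemma valuations_const: "1 \<le> m \<Longrightarrow> valuations m (\<lambda>_. 1)"
  by (auto simp: valuations_def)

lemma valuations_top: "1 \<le> m \<Longrightarrow> valuations m (\<lambda>j. of_bool (j = 1))"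
  by (auto simp: valuations_def)

lemma ExAnte_const_ge:
  assumes G: "type_dists n m G" and "k < n"
  shows "real k \<le> ExAnte k n m G (\<lambda>_. 1)"
proof -
  let ?\<mu> = "\<lambda>j. \<Sum>i\<in>{1..n}. type_prob G i j"
  \<comment> \<open>Since \<open>k < n\<close>, scaling all expected type counts by
    \<open>k / n\<close> respects their upper bounds and uses the capacity exactly.\<close>
  let ?a = "\<lambda>j. real k / real n * ?\<mu> j"
  have \<mu>: "0 \<le> ?\<mu> j" if "j \<in> {1..m}" for j
    using that type_prob_nonneg[OF G] by (intro sum_nonneg) auto
  have "(\<Sum>j\<in>{1..m}. ?\<mu> j) = (\<Sum>i\<in>{1..n}. \<Sum>j\<in>{1..m}. type_prob G i j)"
    by (rule sum.swap)
  also have "\<dots> = (\<Sum>i\<in>{1..n}. 1)"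
    by (intro sum.cong refl sum_type_prob[OF G])
  finally have total: "(\<Sum>j\<in>{1..m}. ?a j) = real k"
    using assms(2) by (simp only: sum_distrib_left[symmetric]) simp
  have "(\<Sum>j\<in>{1..m}. 1 * ?a j) \<le> ExAnte k n m G (\<lambda>_. 1)"
  proof (rule ExAnte_ge_of_feasible[OF G])
    show "valuations m (\<lambda>_. 1)"
      using G by (intro valuations_const) (simp add: type_dists_def)
    show "0 \<le> ?a j \<and> ?a j \<le> ?\<mu> j" if "j \<in> {1..m}" for j
      using \<mu>[OF that] assms(2) mult_right_mono[of "real k / real n" 1 "?\<mu> j"] by simp
  qed (simp only: total order_refl)
  then show ?thesis
    using total by simp
qed

lemma ExAnte_top_ge:
  assumes G: "type_dists n m G" and "1 \<le> k" "k < n"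
  shows "type_prob G n 1 \<le> ExAnte k n m G (\<lambda>j. of_bool (j = 1))"
proof -
  have m: "1 \<in> {1..m}" and n: "n \<in> {1..n}"
    using assms by (auto simp: type_dists_def)
  let ?a = "\<lambda>j. if j = 1 then type_prob G n 1 else 0"
  have sum_a: "(\<Sum>j\<in>{1..m}. ?a j) = type_prob G n 1"
    using m by simp
  have "type_prob G n 1 \<le> (\<Sum>j\<in>{1..m}. type_prob G n j)"
    using m type_prob_nonneg[OF G n] by (intro member_le_sum) auto
  also have "\<dots> = 1"
    by (rule sum_type_prob[OF G n])
  finally have le1: "type_prob G n 1 \<le> 1" .
  have "(\<Sum>j\<in>{1..m}. of_bool (j = 1) * ?a j) \<le> ExAnte k n m G (\<lambda>j. of_bool (j = 1))"
  proof (rule ExAnte_ge_of_feasible[OF G])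
    show "valuations m (\<lambda>j. of_bool (j = 1))"
      using m by (intro valuations_top) auto
    show "(\<Sum>j\<in>{1..m}. ?a j) \<le> real k"
      using sum_a le1 assms(2) by simp
    show "0 \<le> ?a j \<and> ?a j \<le> (\<Sum>i\<in>{1..n}. type_prob G i j)" if j: "j \<in> {1..m}" for j
    proof -
      have "type_prob G n j \<le> (\<Sum>i\<in>{1..n}. type_prob G i j)"
        using n j type_prob_nonneg[OF G] by (intro member_le_sum) auto
      then show ?thesis
        using type_prob_nonneg[OF G n m] type_prob_nonneg[OF G n j] by auto
    qed
  qed
  moreover have "(\<Sum>j\<in>{1..m}. of_bool (j = 1) * ?a j) = (\<Sum>j\<in>{1..m}. ?a j)"
    by (intro sum.cong) auto
  ultimately show ?thesis
    using sum_a by simp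
qed

section \<open>Lower bound: pricing and balanced policies\<close>

text \<open>The bound on the vacancy seen by agent \<open>n\<close>, the last and hence worst
  served, controls the surplus terms of \<open>price_bound\<close>; the bound on \<open>fill\<close>
  controls its price term.\<close>

lemma ALG_ge_price_bound:
  assumes G: "type_dists n m G" and r: "valuations m r" and J: "J \<in> {1..m}"
    and \<alpha>: "0 \<le> \<alpha>" "\<alpha> \<le> vacancy k (n - 1) (policy_prob m G J \<rho>)"
      "\<alpha> * real k \<le> fill k n (policy_prob m G J \<rho>)"
  shows "\<alpha> * price_bound k n m G r J \<le> ALG k n m G J \<rho> r"
proof -
  let ?q = "policy_prob m G J \<rho>"
  let ?d = "\<lambda>i. \<Sum>j\<in>{1..m}. type_prob G i j * max 0 (r j - r J)"
  have rJ: "0 \<le> r J"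
    using r J by (rule valuations_nonneg)
  have gain: "measure_pmf.expectation (pair_pmf (type_pmf m G i) (bernoulli_pmf \<rho>))
      (\<lambda>(y, b). of_bool (accepts J y b) * r y) = ?d i + r J * ?q i" if i: "i \<in> {1..n}" for i
  proof -
    let ?P = "pair_pmf (type_pmf m G i) (bernoulli_pmf \<rho>)"
    have fin: "finite (set_pmf ?P)"
      using finite_set_type_pmf[OF G i] by simp
    \<comment> \<open>Valuations are nonincreasing in the type: types before \<open>J\<close> are
      accepted with nonnegative surplus, types after \<open>J\<close> are rejected and have none,
      and type \<open>J\<close> has surplus 0 whatever the coin.\<close>
    have pointwise: "of_bool (accepts J y b) * r y = max 0 (r y - r J) + of_bool (accepts J y b) * r J"
      if "y \<in> {1..m}" for y b
      using valuations_antimono[OF r, of y J] valuations_antimono[OF r, of J y] that J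
      by (cases y J rule: linorder_cases) (auto simp: accepts_def)
    have "measure_pmf.expectation ?P (\<lambda>(y, b). of_bool (accepts J y b) * r y) =
        measure_pmf.expectation ?P
          (\<lambda>x. max 0 (r (fst x) - r J) + (case x of (y, b) \<Rightarrow> of_bool (accepts J y b)) * r J)"
    \<comment> \<open>Almost sure equality, since \<open>pointwise\<close> covers only types in
      \<open>{1..m}\<close>, which carry all the mass.\<close>
    proof (rule integral_cong_AE; (unfold AE_measure_pmf_iff)?)
      show "\<forall>x\<in>set_pmf ?P. (case x of (y, b) \<Rightarrow> of_bool (accepts J y b) * r y) =
          max 0 (r (fst x) - r J) + (case x of (y, b) \<Rightarrow> of_bool (accepts J y b)) * r J"
      proof
        fix x assume "x \<in> set_pmf ?P"
        then obtain y b where x: "x = (y, b)" and y: "y \<in> {1..m}"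
          using expectation_type_pmf(2)[OF G i] by auto
        show "(case x of (y, b) \<Rightarrow> of_bool (accepts J y b) * r y) =
            max 0 (r (fst x) - r J) + (case x of (y, b) \<Rightarrow> of_bool (accepts J y b)) * r J"
          by (simp only: x case_prod_conv fst_conv pointwise[OF y])
      qed
    qed simp_all
    also have "\<dots> = measure_pmf.expectation ?P (\<lambda>x. max 0 (r (fst x) - r J)) + ?q i * r J"
      by (simp add: expectation_add_pmf_finite[OF fin] accept_prob_def
          del: expectation_pair_pmf_fst)
    also have "measure_pmf.expectation ?P (\<lambda>x. max 0 (r (fst x) - r J)) = ?d i"
      using expectation_pair_pmf_fst[of "type_pmf m G i" "bernoulli_pmf \<rho>" "\<lambda>y. max 0 (r y - r J)"]
      by (simp add: expectation_type_pmf(1)[OF G i])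
    finally show ?thesis
      by (simp add: mult.commute)
  qed
  have "\<alpha> * price_bound k n m G r J = (\<Sum>i\<in>{1..n}. \<alpha> * ?d i) + r J * (\<alpha> * real k)"
    by (simp add: price_bound_def algebra_simps sum_distrib_left)
  also have "\<dots> \<le> (\<Sum>i\<in>{1..n}. vacancy k (i - 1) ?q * ?d i) + r J * fill k n ?q"
  proof (intro add_mono sum_mono mult_right_mono mult_left_mono \<alpha>(3) rJ)
    fix i assume i: "i \<in> {1..n}"
    have "vacancy k (n - 1) ?q \<le> vacancy k (i - 1) ?q"
      using i by (intro vacancy_antimono_agents accept_prob_in_unit) auto
    then show "\<alpha> \<le> vacancy k (i - 1) ?q"
      using \<alpha>(2) by simp
    show "0 \<le> ?d i"
      using type_prob_nonneg[OF G i] by (intro sum_nonneg mult_nonneg_nonneg) auto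
  qed
  also have "\<dots> = (\<Sum>i\<in>{1..n}. vacancy k (i - 1) ?q * (?d i + r J * ?q i))"
    unfolding fill_eq_sum[OF accept_prob_in_unit] sum_distrib_left sum.distrib[symmetric]
    by (intro sum.cong) (auto simp: algebra_simps sum_distrib_left)
  also have "\<dots> = ALG k n m G J \<rho> r"
    unfolding ALG_eq[OF G] by (intro sum.cong refl) (simp only: gain)
  finally show ?thesis .
qed

lemma ALG_nonneg:
  assumes "type_dists n m G" "valuations m r" "J \<in> {1..m}"
  shows "0 \<le> ALG k n m G J \<rho> r"
  using ALG_ge_price_bound[OF assms, of 0] by (simp add: vacancy_bounds fill_nonneg)

lemma vacancy_fill_cong:
  assumes "\<And>i. i \<in> {1..n} \<Longrightarrow> q i = q' i"
  shows "vacancy k n q = vacancy k n q'" "fill k n q = fill k n q'"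
  using bernoulli_sum_pmf_cong[of "{1..n}" q q'] assms by (simp_all add: vacancy_def fill_def)

text \<open>The gap \<open>?\<Phi>\<close> is 1 when nobody is wanted and -1 when everybody is. The
  first column of \<open>G\<close> where it is no longer positive fixes \<open>J\<close>; the
  intermediate value theorem on the segment from the previous column fixes
  \<open>\<rho>\<close>.\<close>

lemma balanced_policy_exists:
  assumes G: "type_dists n m G" and "1 \<le> k" "k < n"
  obtains J \<rho> where "J \<in> {1..m}" "\<rho> \<in> {0<..1}"
    "vacancy k (n - 1) (policy_prob m G J \<rho>) = fill k (n - 1) (policy_prob m G J \<rho>) / real k"
proof -
  let ?\<Phi> = "\<lambda>q. vacancy k (n - 1) q - fill k (n - 1) q / real k"
  let ?h = "\<lambda>l. ?\<Phi> (\<lambda>i. G i l)"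
  have m: "1 \<le> m" and G0: "\<And>i. i \<in> {1..n - 1} \<Longrightarrow> G i 0 = 0"
    and Gm: "\<And>i. i \<in> {1..n - 1} \<Longrightarrow> G i m = 1"
    using G by (auto simp: type_dists_def)
  have h0: "?h 0 = 1"
    using bernoulli_sum_exp_0[of "{1..n - 1}" "\<lambda>i. G i 0"] G0 assms(2)
    by (simp add: vacancy_def fill_def)
  \<comment> \<open>Here \<open>k < n\<close> matters: all \<open>n - 1\<close> agents are wanted,
    at least \<open>k\<close> of them, so every slot is filled.\<close>
  have hm: "?h m = - 1"
    using bernoulli_sum_exp_1[of "{1..n - 1}" "\<lambda>i. G i m"] Gm assms(2,3)
    by (simp add: vacancy_def fill_def)
  define J where "J = (LEAST l. ?h l \<le> 0)"
  have hJ: "?h J \<le> 0"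
    unfolding J_def by (rule LeastI[of "\<lambda>l. ?h l \<le> 0" m]) (use hm in simp)
  have "J \<le> m"
    unfolding J_def by (rule Least_le) (use hm in simp)
  moreover have "J \<noteq> 0"
    using hJ h0 by (metis not_one_le_zero)
  ultimately have J: "J \<in> {1..m}"
    by auto
  then have "\<not> ?h (J - 1) \<le> 0"
    using not_less_Least[of "J - 1" "\<lambda>l. ?h l \<le> 0"] unfolding J_def[symmetric] by auto
  then have hJ': "?h (J - 1) > 0"
    by simp
  let ?q = "\<lambda>\<rho> i. G i (J - 1) + \<rho> * type_prob G i J"
  have q: "policy_prob m G J \<rho> i = ?q \<rho> i" if "i \<in> {1..n - 1}" "\<rho> \<in> {0..1}" for \<rho> i
    using that by (intro policy_prob_eq[OF G _ J]) auto
  let ?S = "{q. \<forall>i\<in>{1..n - 1}. q i \<in> {0..1 :: real}}"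
  have q_cont: "continuous_on {0..1} ?q"
    by (intro continuous_on_coordinatewise_then_product continuous_intros)
  have q_S: "?q ` {0..1} \<subseteq> ?S"
  proof safe
    fix \<rho> :: real and i
    assume "\<rho> \<in> {0..1}" "i \<in> {1..n - 1}"
    then show "?q \<rho> i \<in> {0..1}"
      using q[of i \<rho>] accept_prob_in_unit[of "type_pmf m G" J \<rho> i] by simp
  qed
  have cont: "continuous_on ?S (vacancy k (n - 1))" "continuous_on ?S (fill k (n - 1))"
    by (rule continuous_on_vacancy_fill; simp)+
  have "continuous_on {0..1} (\<lambda>\<rho>. ?\<Phi> (?q \<rho>))"
    unfolding divide_inverse
    by (intro continuous_intros continuous_on_compose2[OF cont(1) q_cont q_S]
        continuous_on_compose2[OF cont(2) q_cont q_S])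
  moreover have "?\<Phi> (?q 0) = ?h (J - 1)"
    by simp
  moreover have "?\<Phi> (?q 1) = ?h J"
    by (simp add: type_prob_def)
  ultimately obtain \<rho> where \<rho>: "0 \<le> \<rho>" "\<rho> \<le> 1" "?\<Phi> (?q \<rho>) = 0"
    using IVT2'[of "\<lambda>\<rho>. ?\<Phi> (?q \<rho>)" 1 0 0] hJ hJ' by auto
  \<comment> \<open>The gap is strictly positive at 0 because \<open>J\<close> is least, so the root
    is an admissible coin probability.\<close>
  have "\<rho> \<noteq> 0"
    using \<rho>(3) hJ' by auto
  moreover have "?\<Phi> (policy_prob m G J \<rho>) = ?\<Phi> (?q \<rho>)"
    using vacancy_fill_cong[of "n - 1" "policy_prob m G J \<rho>" "?q \<rho>"] q \<rho>(1,2) by simp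
  ultimately show ?thesis
    using that[OF J, of \<rho>] \<rho> by simp
qed

section \<open>Upper bound: the hard instances\<close>

text \<open>
  Up to \<open>\<epsilon>\<close>, policies with \<open>J \<le> 2\<close> fill at most as many slots as \<open>q\<close>; those with \<open>J = 3\<close> leave a slot
  for agent \<open>n\<close> at most as often as \<open>q\<close>.
\<close>

definition hard_dists :: "nat \<Rightarrow> (nat \<Rightarrow> real) \<Rightarrow> real \<Rightarrow> nat \<Rightarrow> nat \<Rightarrow> real" where
  "hard_dists n q \<epsilon> i j =
     (if j = 0 then 0
      else if j = 1 then (if i = n then \<epsilon> else 0)
      else if j = 2 then (if i = n then \<epsilon> else q i)
      else 1)"

lemma type_dists_hard_dists:
  assumes "\<forall>i\<in>{1..n - 1}. q i \<in> {0..1}" "\<epsilon> \<in> {0..1}"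
  shows "type_dists n 3 (hard_dists n q \<epsilon>)"
proof -
  have "{1..3::nat} = {1, 2, 3}"
    by auto
  moreover have "0 \<le> q i \<and> q i \<le> 1" if "i \<in> {1..n}" "i \<noteq> n" for i
    using that assms(1) by auto
  ultimately show ?thesis
    using assms(2) by (auto simp: type_dists_def hard_dists_def)
qed

text \<open>\<open>b1\<close> and \<open>b2\<close> stand for the benchmark at the constant and at
  the top-type valuation, so one argument covers both benchmarks. Thresholds
  \<open>J \<le> 2\<close> do badly on the first valuation, \<open>J = 3\<close> on the
  second.\<close>

lemma hard_dists_ratio_le:
  assumes "1 \<le> k" "k < n" and q: "\<forall>i\<in>{1..n - 1}. q i \<in> {0..1}"
    and \<alpha>: "\<alpha> = vacancy k (n - 1) q" "\<alpha> = fill k (n - 1) q / real k"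
    and \<epsilon>: "0 < \<epsilon>" "\<epsilon> \<le> 1" and G: "G = hard_dists n q \<epsilon>"
    and J: "J \<in> {1..3}" and \<rho>: "\<rho> \<in> {0<..1}"
    and const: "real k \<le> b1" and top: "type_prob G n 1 \<le> b2"
  shows "ALG k n 3 G J \<rho> (\<lambda>_. 1) / b1 \<le> \<alpha> + \<epsilon>
    \<or> ALG k n 3 G J \<rho> (\<lambda>j. of_bool (j = 1)) / b2 \<le> \<alpha>"
proof -
  have td: "type_dists n 3 G"
    unfolding G using q \<epsilon> by (intro type_dists_hard_dists) auto
  let ?p = "policy_prob 3 G J \<rho>"
  have \<rho>': "0 \<le> \<rho>" "\<rho> \<le> 1"
    using \<rho> by auto
  have p: "?p i = G i (J - 1) + \<rho> * type_prob G i J" if "i \<in> {1..n}" for i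
    using that \<rho>' by (intro policy_prob_eq[OF td _ J]) auto
  have n: "n = Suc (n - 1)"
    using assms(2) by simp
  have \<alpha>0: "0 \<le> \<alpha>"
    using \<alpha>(1) by (simp add: vacancy_bounds)
  show ?thesis
  proof (cases "J = 3")
    case False
    then have J12: "J = 1 \<or> J = 2"
      using J by auto
    \<comment> \<open>Before agent \<open>n\<close>, type 1 has probability 0 and type 2 has
      probability \<open>q i\<close>.\<close>
    have "?p i \<le> q i" if "i \<in> {1..n - 1}" for i
    proof -
      have "\<rho> * q i \<le> 1 * q i"
        using q that \<rho>' by (intro mult_right_mono) auto
      moreover have "0 \<le> q i" "i \<noteq> n" "i \<in> {1..n}"
        using q that by auto
      ultimately show ?thesis
        using J12 p[of i] by (auto simp: G hard_dists_def type_prob_def)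
    qed
    then have "fill k (n - 1) ?p \<le> fill k (n - 1) q"
      using q accept_prob_in_unit[of "type_pmf 3 G" J \<rho>] by (intro fill_mono) auto
    moreover have pn: "?p n \<le> \<epsilon>"
    proof -
      have "\<rho> * \<epsilon> \<le> 1 * \<epsilon>"
        using \<epsilon> \<rho>' by (intro mult_right_mono) auto
      then show ?thesis
        using J12 p[of n] assms(2) by (auto simp: G hard_dists_def type_prob_def)
    qed
    \<comment> \<open>Agent \<open>n\<close> adds at most \<open>\<epsilon>\<close> to the expected
      number of filled slots.\<close>
    moreover have "vacancy k (n - 1) ?p * ?p n \<le> 1 * \<epsilon>"
      using pn accept_prob_in_unit[of "type_pmf 3 G" J \<rho> n]
      by (intro mult_mono vacancy_bounds) auto
    moreover have "fill k n ?p = fill k (n - 1) ?p + vacancy k (n - 1) ?p * ?p n"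
      using fill_Suc[of ?p "n - 1" k] accept_prob_in_unit n by metis
    ultimately have "ALG k n 3 G J \<rho> (\<lambda>_. 1) \<le> fill k (n - 1) q + \<epsilon>"
      unfolding ALG_const[OF td] by simp
    also have "\<dots> = \<alpha> * real k + \<epsilon>"
      using \<alpha>(2) assms(1) by simp
    also have "\<dots> \<le> (\<alpha> + \<epsilon>) * real k"
      using assms(1) \<epsilon> mult_left_mono[of 1 "real k" \<epsilon>] by (simp add: algebra_simps)
    also have "\<dots> \<le> (\<alpha> + \<epsilon>) * b1"
      using \<alpha>0 \<epsilon> const by (intro mult_left_mono) auto
    finally show ?thesis
      using const assms(1) by (simp add: divide_le_eq)
  next
    case True
    \<comment> \<open>With \<open>J = 3\<close>, types 1 and 2 are always wanted; before agent
      \<open>n\<close> they have total probability \<open>q i\<close>.\<close>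
    have "q i \<le> ?p i" if "i \<in> {1..n - 1}" for i
    proof -
      have "0 \<le> q i" "q i \<le> 1" "i \<noteq> n" "i \<in> {1..n}"
        using q that by auto
      then show ?thesis
        using True p[of i] \<rho>' by (auto simp: G hard_dists_def type_prob_def)
    qed
    then have vac: "vacancy k (n - 1) ?p \<le> \<alpha>"
      unfolding \<alpha>(1) using q accept_prob_in_unit[of "type_pmf 3 G" J \<rho>]
      by (intro vacancy_antimono) auto
    \<comment> \<open>Only agent \<open>n\<close> can have type 1, so nobody else earns
      anything.\<close>
    have gain: "measure_pmf.expectation (pair_pmf (type_pmf 3 G i) (bernoulli_pmf \<rho>))
        (\<lambda>(y, b). of_bool (accepts J y b) * of_bool (y = 1)) = (if i = n then \<epsilon> else 0)"
      if i: "i \<in> {1..n}" for i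
    proof -
      have "(\<lambda>(y, b). of_bool (accepts J y b) * of_bool (y = 1)) =
          (\<lambda>x. of_bool (fst x = 1) :: real)"
        using True by (auto simp: fun_eq_iff accepts_def)
      then have "measure_pmf.expectation (pair_pmf (type_pmf 3 G i) (bernoulli_pmf \<rho>))
          (\<lambda>(y, b). of_bool (accepts J y b) * of_bool (y = 1)) =
          measure_pmf.expectation (type_pmf 3 G i) (\<lambda>y. of_bool (y = 1) :: real)"
        using expectation_pair_pmf_fst[of "type_pmf 3 G i" "bernoulli_pmf \<rho>" "\<lambda>y. of_bool (y = 1) :: real"]
        by simp
      also have "\<dots> = (if i = n then \<epsilon> else 0)"
        unfolding expectation_type_pmf(1)[OF td i]
        by (simp add: of_bool_def if_distrib type_prob_def G hard_dists_def cong: if_cong)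
      finally show ?thesis .
    qed
    have "ALG k n 3 G J \<rho> (\<lambda>j. of_bool (j = 1)) =
        (\<Sum>i\<in>{1..n}. vacancy k (i - 1) ?p * (if i = n then \<epsilon> else 0))"
      unfolding ALG_eq[OF td] by (intro sum.cong refl) (simp only: gain)
    also have "\<dots> = vacancy k (n - 1) ?p * \<epsilon>"
      using assms(2) by (simp add: if_distrib cong: if_cong)
    also have "\<dots> \<le> \<alpha> * \<epsilon>"
      using vac \<epsilon> by (intro mult_right_mono) auto
    also have top': "\<epsilon> \<le> b2"
      using top by (simp add: G hard_dists_def type_prob_def)
    then have "\<alpha> * \<epsilon> \<le> \<alpha> * b2"
      using \<alpha>0 by (intro mult_left_mono)
    finally show ?thesis
      using top' \<epsilon> by (simp add: divide_le_eq)
  qed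
qed

text \<open>Both benchmarks are handled at once: the price bound drives the lower bound on the
  guarantee, the estimates at the two special valuations the upper one.\<close>

lemma OST_guarantee_optimal:
  assumes k: "1 \<le> k" and n: "k < n"
    and upper: "\<And>m G r J. type_dists n m G \<Longrightarrow> valuations m r \<Longrightarrow> J \<in> {1..m} \<Longrightarrow>
      B k n m G r \<le> price_bound k n m G r J"
    and const: "\<And>m G. type_dists n m G \<Longrightarrow> real k \<le> B k n m G (\<lambda>_. 1)"
    and top: "\<And>m G. type_dists n m G \<Longrightarrow> type_prob G n 1 \<le> B k n m G (\<lambda>j. of_bool (j = 1))"
  shows "is_optimal_value k n (OST_guarantee B k n)"
proof -
  let ?V = "\<lambda>m G. {r. valuations m r \<and> 0 < B k n m G r}"
  let ?ratio = "\<lambda>m G J \<rho> r. ALG k n m G J \<rho> r / B k n m G r"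
  let ?R = "\<lambda>m G J \<rho>. INF r\<in>?V m G. ?ratio m G J \<rho> r"
  let ?P = "\<lambda>m::nat. {1..m} \<times> {0<..1::real}"
  let ?A = "\<lambda>m G. SUP (J, \<rho>)\<in>?P m. ?R m G J \<rho>"
  let ?I = "{(m, G). type_dists n m G}"
  \<comment> \<open>Constant valuations keep the inner infimum over a nonempty set and below cap it
    by 1; real infima and suprema need such nonemptiness and bounds.\<close>
  have one: "(\<lambda>_. 1) \<in> ?V m G" if "type_dists n m G" for m G
    using that const[OF that] k valuations_const[of m] by (simp add: type_dists_def)
  have R_le: "?R m G J \<rho> \<le> ?ratio m G J \<rho> r"
    if "type_dists n m G" "J \<in> {1..m}" "r \<in> ?V m G" for m G J \<rho> r
    using that by (intro cINF_lower bdd_belowI[of _ 0]) (auto intro!: divide_nonneg_pos ALG_nonneg)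
  have bdd: "bdd_above ((\<lambda>(J, \<rho>). ?R m G J \<rho>) ` ?P m)" if td: "type_dists n m G" for m G
  proof (rule bdd_aboveI[of _ 1], safe)
    fix J \<rho> assume J: "J \<in> {1..m}"
    have "?R m G J \<rho> \<le> ?ratio m G J \<rho> (\<lambda>_. 1)"
      by (rule R_le[OF td J one[OF td]])
    also have "\<dots> \<le> 1"
      using const[OF td] k fill_le[of k n "policy_prob m G J \<rho>"]
      by (simp add: ALG_const[OF td] divide_le_eq)
    finally show "?R m G J \<rho> \<le> 1" .
  qed
  have attain: "\<exists>\<alpha>\<in>feasible_values k n. \<alpha> \<le> ?A m G" if td: "type_dists n m G" for m G
  proof -
    obtain J \<rho> where J: "J \<in> {1..m}" and \<rho>: "\<rho> \<in> {0<..1}"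
      and bal: "vacancy k (n - 1) (policy_prob m G J \<rho>) = fill k (n - 1) (policy_prob m G J \<rho>) / real k"
      using balanced_policy_exists[OF td k n] by blast
    let ?q = "policy_prob m G J \<rho>"
    let ?\<alpha> = "vacancy k (n - 1) ?q"
    have "?\<alpha> \<in> feasible_values k n"
      unfolding feasible_values_altdef
      by (rule CollectI, rule exI[of _ ?q]) (use bal accept_prob_in_unit in blast)
    moreover have "?\<alpha> \<le> ?R m G J \<rho>"
    proof (rule cINF_greatest)
      show "?V m G \<noteq> {}"
        using one[OF td] by blast
      fix r assume r: "r \<in> ?V m G"
      \<comment> \<open>Balance concerns the first \<open>n - 1\<close> agents; with all
        \<open>n\<close> at least as many slots are filled.\<close>
      have "fill k (Suc (n - 1)) ?q = fill k (n - 1) ?q + ?\<alpha> * ?q (Suc (n - 1))"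
        by (rule fill_Suc[OF accept_prob_in_unit])
      then have "fill k (n - 1) ?q \<le> fill k n ?q"
        using n vacancy_bounds(1)[of k "n - 1" ?q] accept_prob_in_unit[of "type_pmf m G" J \<rho> n] by simp
      moreover have "?\<alpha> * real k = fill k (n - 1) ?q"
        using bal k by simp
      ultimately have "?\<alpha> * price_bound k n m G r J \<le> ALG k n m G J \<rho> r"
        using r by (intro ALG_ge_price_bound[OF td _ J] vacancy_bounds) auto
      moreover have "?\<alpha> * B k n m G r \<le> ?\<alpha> * price_bound k n m G r J"
        using r by (intro mult_left_mono upper[OF td _ J] vacancy_bounds) auto
      ultimately show "?\<alpha> \<le> ?ratio m G J \<rho> r"
        using r by (simp add: le_divide_eq)
    qed
    moreover have "?R m G J \<rho> \<le> ?A m G"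
      using cSUP_upper[OF _ bdd[OF td], of "(J, \<rho>)"] J \<rho> by simp
    ultimately show ?thesis
      by (meson order_trans)
  qed
  \<comment> \<open>Some instance exists, with a single type; through \<open>attain\<close>, so does
    a feasible value.\<close>
  have td1: "type_dists n 1 (\<lambda>i j. real j)"
    by (simp add: type_dists_def)
  obtain v where v: "v \<in> feasible_values k n" "\<forall>\<alpha>\<in>feasible_values k n. v \<le> \<alpha>"
    using attain[OF td1] feasible_values_attains_min[of k n] by blast
  have v_le: "v \<le> ?A m G" if "type_dists n m G" for m G
    using attain[OF that] v(2) by fastforce
  have OST: "OST_guarantee B k n = (INF (m, G)\<in>?I. ?A m G)"
    by (simp add: OST_guarantee_def)
  have "v \<le> OST_guarantee B k n"
    unfolding OST using td1 v_le by (intro cINF_greatest) auto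
  moreover have "OST_guarantee B k n \<le> v"
  proof (rule field_le_epsilon)
    fix e :: real assume "0 < e"
    \<comment> \<open>Capped at 1 since it serves as a probability in
      \<open>hard_dists\<close>.\<close>
    define \<epsilon> where "\<epsilon> = min e 1"
    have \<epsilon>: "0 < \<epsilon>" "\<epsilon> \<le> 1" "\<epsilon> \<le> e"
      using \<open>0 < e\<close> by (auto simp: \<epsilon>_def)
    obtain q where q: "\<forall>i\<in>{1..n - 1}. q i \<in> {0..1}"
      "v = vacancy k (n - 1) q" "v = fill k (n - 1) q / real k"
      using v(1) unfolding feasible_values_altdef by blast
    define G where "G = hard_dists n q \<epsilon>"
    have td: "type_dists n 3 G"
      unfolding G_def using q(1) \<epsilon> by (intro type_dists_hard_dists) auto
    have topV: "(\<lambda>j. of_bool (j = 1)) \<in> ?V 3 G"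
    proof -
      have "type_prob G n 1 = \<epsilon>"
        by (simp add: G_def hard_dists_def type_prob_def)
      then show ?thesis
        using top[OF td] \<epsilon> valuations_top[of 3] by simp
    qed
    have "OST_guarantee B k n \<le> ?A 3 G"
    proof -
      have "bdd_below ((\<lambda>(m, G). ?A m G) ` ?I)"
      proof (rule bdd_belowI[of _ v], safe)
        fix m G assume "type_dists n m G"
        then show "v \<le> ?A m G"
          by (rule v_le)
      qed
      moreover have "(3, G) \<in> ?I"
        using td by simp
      ultimately show ?thesis
        unfolding OST by (rule cINF_lower[of "\<lambda>(m, G). ?A m G" ?I "(3, G)", unfolded prod.case])
    qed
    also have "?A 3 G \<le> v + e"
    proof (rule cSUP_least)
      have "(1, 1) \<in> ?P 3"
        by simp
      then show "?P 3 \<noteq> {}"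
        by blast
      fix x assume "x \<in> ?P 3"
      then obtain J \<rho> where x: "x = (J, \<rho>)" and J: "J \<in> {1..3}" and \<rho>: "\<rho> \<in> {0<..1}"
        by blast
      \<comment> \<open>Either alternative bounds one of the two ratios, and the infimum lies below
        both.\<close>
      have "?R 3 G J \<rho> \<le> v + \<epsilon>"
        using hard_dists_ratio_le[OF k n q \<epsilon>(1,2) G_def J \<rho> const[OF td] top[OF td]]
          R_le[OF td J one[OF td], of \<rho>] R_le[OF td J topV, of \<rho>] \<epsilon>(1) by linarith
      then show "(case x of (J, \<rho>) \<Rightarrow> ?R 3 G J \<rho>) \<le> v + e"
        using x \<epsilon>(3) by simp
    qed
    finally show "OST_guarantee B k n \<le> v + e" .
  qed
  ultimately have "OST_guarantee B k n = v"
    by simp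
  then show ?thesis
    using v by (simp add: is_optimal_value_def)
qed

theorem corollary1:
  fixes k n :: nat
  assumes "1 \<le> k" and "k < n"
  shows "is_optimal_value k n (OST_guarantee Proph k n)
    \<and> is_optimal_value k n (OST_guarantee ExAnte k n)"
  using assms
  by (intro conjI OST_guarantee_optimal Proph_le_price_bound Proph_const_ge Proph_top_ge
      ExAnte_le_price_bound ExAnte_const_ge ExAnte_top_ge)

end
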